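(* Let $B$ be a complete Boolean algebra with $0\neq 1$. If $B$ is not isomorphic to the two-element Boolean algebra $\{0,1\}$ (equivalently, $B$ has some element $a$ with $0<a<1$), then none of the following lies in $\mathsf{Log}_{\subseteq}^{\sharp}(B)$: $\Box p\leftrightarrow p$ (for $p$ a propositional variable); the schema (4) $\Box\varphi\to\Box\Box\varphi$; the schema (5) $\Diamond\varphi\to\Box\Diamond\varphi$. (For a schema, this means that some instance of it is not in $\mathsf{Log}_{\subseteq}^{\sharp}(B)$.)
   Context: The propositional modal language has a countable set $\mathsf{Prop}$ of propositional variables, the Boolean connectives, $\Box$ and $\Diamond$. Boolean-valued models. For a complete Boolean algebra $B$ (bottom $0$, top $1$, complement $a^\ast$, $a\to b:=a^\ast\vee b$), define by transfinite recursion $V^{(B)}_\alpha=\{x: x$ is a function, $\mathrm{ran}(x)\subseteq B$, and $\mathrm{dom}(x)\subseteq V^{(B)}_\xi$ for some $\xi<\alpha\}$ and $V^{(B)}=\bigcup_\alpha V^{(B)}_\alpha$. $L_B$ is the first-order language of set theory expanded by a constant symbol for each element of $V^{(B)}$, and $\mathsf{Sent}(L_B)$ is the class of its sentences. The Boolean value $\llbracket\cdot\rrbracket_B:\mathsf{Sent}(L_B)\to B$ is defined recursively by $\llbracket u\in v\rrbracket_B=\bigvee_{x\in\mathrm{dom}(v)}(v(x)\wedge\llbracket x=u\rrbracket_B)$, $\llbracket u=v\rrbracket_B=\bigwedge_{x\in\mathrm{dom}(u)}(u(x)\to\llbracket x\in v\rrbracket_B)\wedge\bigwedge_{y\in\mathrm{dom}(v)}(v(y)\to\llbracket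 y\in u\rrbracket_B)$, the Boolean operations for the connectives, and meets (resp. joins) over $V^{(B)}$ for $\forall$ (resp. $\exists$). Translation models. $B^+:=B\setminus\{0\}$. A $B$-translation is a map $T:\mathsf{Prop}\to\mathsf{Sent}(L_B)$; it induces $v_T:\mathsf{Prop}\to B$, $v_T(p)=\llbracket T(p)\rrbracket_B$. For nonempty $W\subseteq B^+$, $M_{B,W,T}$ is the Kripke model with set of states $W$, accessibility $aRb\iff a\wedge b\neq 0$, and atomic satisfaction $M_{B,W,T},b\models p\iff b\le v_T(p)$; other connectives and modalities are interpreted by the usual Kripke clauses. $M_{B,W,T}\models\varphi$ means that $\varphi$ holds at every $b\in W$. $\mathsf{Log}_{\subseteq}^{\sharp}(B)$ is the set of modal formulas $\varphi$ such that $M_{B,W,T}\models\varphi$ for all nonempty $W\subseteq B^+$ and all $B$-translations $T$. *)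

theory Defs
  imports "HOL-Library.Multiset" "HOL-Library.Countable"
begin

unbundle lattice_syntax

section \<open>The set-theoretic universe\<close>

text \<open>
  The Boolean-valued universe is a proper class of sets obtained by recursion over all ordinals, so
  it is built inside a type that carries a set-theoretic universe.  Only the axioms of ZF without
  Power Set are required: the stages below are HOL-sets of elements of the universe, and need not be
  sets of the universe themselves.  Foundation and Replacement are second order, i.e. they
  range over all HOL predicates.  Every (second-order) universe of ZFC is an instance.  Unlike full ZFC, these
  axioms also have models in plain HOL, such as the sets hereditarily of cardinality at most
  \<open>\<kappa>\<close>, for \<open>\<kappa>\<close> infinite.
\<close>

class set_universe =
  fixes elem :: "'a \<Rightarrow> 'a \<Rightarrow> bool"  (infix "\<^bold>\<in>" 50)
  assumes extensionality: "(\<And>z. z \<^bold>\<in> x \<longleftrightarrow> z \<^bold>\<in> y) \<Longrightarrow> x = y"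
    and foundation: "wfp elem"
    and pairing: "\<exists>s. \<forall>z. z \<^bold>\<in> s \<longleftrightarrow> z = x \<or> z = y"
    and union: "\<exists>s. \<forall>z. z \<^bold>\<in> s \<longleftrightarrow> (\<exists>y. y \<^bold>\<in> x \<and> z \<^bold>\<in> y)"
    and replacement: "(\<And>u v w. R u v \<Longrightarrow> R u w \<Longrightarrow> v = w) \<Longrightarrow>
          \<exists>s. \<forall>z. z \<^bold>\<in> s \<longleftrightarrow> (\<exists>u. u \<^bold>\<in> x \<and> R u z)"
    and infinity: "\<exists>s. (\<exists>e. e \<^bold>\<in> s \<and> (\<forall>z. \<not> z \<^bold>\<in> e)) \<and>
          (\<forall>x. x \<^bold>\<in> s \<longrightarrow> (\<exists>y. y \<^bold>\<in> s \<and> (\<forall>z. z \<^bold>\<in> y \<longleftrightarrow> z \<^bold>\<in> x \<or> z = x)))"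

definition upair :: "'v::set_universe \<Rightarrow> 'v \<Rightarrow> 'v" where
  "upair x y = (THE s. \<forall>z. z \<^bold>\<in> s \<longleftrightarrow> z = x \<or> z = y)"

definition opair :: "'v::set_universe \<Rightarrow> 'v \<Rightarrow> 'v" where
  "opair x y = upair (upair x x) (upair x y)"

definition is_function :: "'v::set_universe \<Rightarrow> bool" where
  "is_function f \<longleftrightarrow> (\<forall>z. z \<^bold>\<in> f \<longrightarrow> (\<exists>x y. z = opair x y)) \<and>
     (\<forall>x y y'. opair x y \<^bold>\<in> f \<longrightarrow> opair x y' \<^bold>\<in> f \<longrightarrow> y = y')"

definition vdom :: "'v::set_universe \<Rightarrow> 'v set" where
  "vdom f = {x. \<exists>y. opair x y \<^bold>\<in> f}"

definition vran :: "'v::set_universe \<Rightarrow> 'v set" where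
  "vran f = {y. \<exists>x. opair x y \<^bold>\<in> f}"

definition transitive_set :: "'v::set_universe \<Rightarrow> bool" where
  "transitive_set x \<longleftrightarrow> (\<forall>y z. y \<^bold>\<in> x \<longrightarrow> z \<^bold>\<in> y \<longrightarrow> z \<^bold>\<in> x)"

definition ordinal :: "'v::set_universe \<Rightarrow> bool" where
  "ordinal x \<longleftrightarrow> transitive_set x \<and> (\<forall>y. y \<^bold>\<in> x \<longrightarrow> transitive_set y)"

lemma upair_iff [simp]: "z \<^bold>\<in> upair x y \<longleftrightarrow> z = x \<or> z = y"
proof -
  obtain s where s: "\<forall>z. z \<^bold>\<in> s \<longleftrightarrow> z = x \<or> z = y"
    using pairing by blast
  have "\<forall>z. z \<^bold>\<in> upair x y \<longleftrightarrow> z = x \<or> z = y"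
    unfolding upair_def by (rule theI[of _ s]) (use s extensionality in blast)+
  then show ?thesis by blast
qed

definition dom_rel :: "('v::set_universe \<times> 'v) set" where
  "dom_rel = {(x, f). x \<in> vdom f}"

lemma wf_dom_rel: "wf (dom_rel :: ('v::set_universe \<times> 'v) set)"
proof -
  let ?E = "{(x, y :: 'v). x \<^bold>\<in> y}"
  have "wf ?E" using foundation by (simp add: wfp_def)
  then have "wf (?E\<^sup>+)" by (rule wf_trancl)
  moreover have "(x, f) \<in> ?E\<^sup>+" if "x \<in> vdom f" for x f :: 'v
  proof -
    have "\<exists>y. opair x y \<^bold>\<in> f" using that by (simp add: vdom_def)
    then obtain y where "opair x y \<^bold>\<in> f" ..
    moreover have "x \<^bold>\<in> upair x x" "upair x x \<^bold>\<in> opair x y" by (simp_all add: opair_def)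
    ultimately show ?thesis by (blast intro: r_into_trancl trancl_trans)
  qed
  then have "dom_rel \<subseteq> ?E\<^sup>+" by (auto simp: dom_rel_def)
  ultimately show ?thesis by (rule wf_subset)
qed


section \<open>Boolean-valued models\<close>

text \<open>
  A complete Boolean algebra is a type of sort \<open>{boolean_algebra, complete_lattice}\<close>.
  The library class \<open>complete_boolean_algebra\<close> is not used because it also demands complete
  distributivity, which makes the algebra atomic.

  In the universe the elements of the algebra are represented by sets through an injection
  \<open>c\<close> whose range is a set of the universe.
\<close>

definition represents_in_universe :: "('b \<Rightarrow> 'v::set_universe) \<Rightarrow> bool" where
  "represents_in_universe c \<longleftrightarrow> inj c \<and> (\<exists>s. \<forall>z. z \<^bold>\<in> s \<longleftrightarrow> z \<in> range c)"

function V_stage :: "('b \<Rightarrow> 'v::set_universe) \<Rightarrow> 'v \<Rightarrow> 'v set" where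
  "V_stage c \<alpha> = {x. is_function x \<and> vran x \<subseteq> range c \<and>
                      (\<exists>\<xi>\<in>{\<xi>. \<xi> \<^bold>\<in> \<alpha>}. vdom x \<subseteq> V_stage c \<xi>)}"
  by auto
termination
  by (relation "inv_image {(\<xi>, \<alpha>). \<xi> \<^bold>\<in> \<alpha>} snd")
    (use foundation in \<open>auto simp: wfp_def intro: wf_inv_image\<close>)

declare V_stage.simps [simp del]

definition VB :: "('b \<Rightarrow> 'v::set_universe) \<Rightarrow> 'v set" where
  "VB c = (\<Union>\<alpha>\<in>{\<alpha>. ordinal \<alpha>}. V_stage c \<alpha>)"

text \<open>The value \<open>u(x)\<close> of a name; meaningful for \<open>u \<in> VB c\<close> and \<open>x \<in> vdom u\<close>.\<close>

definition name_val :: "('b \<Rightarrow> 'v::set_universe) \<Rightarrow> 'v \<Rightarrow> 'v \<Rightarrow> 'b" where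
  "name_val c u x = (THE b. opair x (c b) \<^bold>\<in> u)"

abbreviation bimp :: "'b::boolean_algebra \<Rightarrow> 'b \<Rightarrow> 'b" where
  "bimp a b \<equiv> - a \<squnion> b"

function bmem :: "('b::{boolean_algebra, complete_lattice} \<Rightarrow> 'v::set_universe) \<Rightarrow> 'v \<Rightarrow> 'v \<Rightarrow> 'b"
  and beq :: "('b \<Rightarrow> 'v) \<Rightarrow> 'v \<Rightarrow> 'v \<Rightarrow> 'b" where
  "bmem c u v = (\<Squnion>x\<in>vdom v. name_val c v x \<sqinter> beq c x u)"
| "beq c u v = (\<Sqinter>x\<in>vdom u. bimp (name_val c u x) (bmem c x v)) \<sqinter>
               (\<Sqinter>y\<in>vdom v. bimp (name_val c v y) (bmem c y u))"
  by pat_completeness auto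
termination
proof (relation "inv_image (mult dom_rel)
    (\<lambda>s. case s of Inl (c, u, v) \<Rightarrow> {#u, v#} | Inr (c, u, v) \<Rightarrow> {#u, v#})", goal_cases)
  case 1
  show ?case by (intro wf_inv_image wf_mult wf_dom_rel)
next
  case (2 c u v x)
  then have "({#u#} + {#x#}, {#u#} + {#v#}) \<in> mult dom_rel"
    by (intro one_step_implies_mult) (auto simp: dom_rel_def)
  then show ?case by (simp add: add_mset_commute)
next
  case (3 c u v x)
  then have "({#v#} + {#x#}, {#v#} + {#u#}) \<in> mult dom_rel"
    by (intro one_step_implies_mult) (auto simp: dom_rel_def)
  then show ?case by (simp add: add_mset_commute)
next
  case (4 c u v y)
  then have "({#u#} + {#y#}, {#u#} + {#v#}) \<in> mult dom_rel"
    by (intro one_step_implies_mult) (auto simp: dom_rel_def)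
  then show ?case by (simp add: add_mset_commute)
qed

declare bmem.simps [simp del] beq.simps [simp del]

datatype 'v trm = Var nat | Const 'v

datatype 'v fml =
    FMem "'v trm" "'v trm"
  | FEq "'v trm" "'v trm"
  | FFalse
  | FNot "'v fml"
  | FAnd "'v fml" "'v fml"
  | FOr "'v fml" "'v fml"
  | FImp "'v fml" "'v fml"
  | FIff "'v fml" "'v fml"
  | FAll nat "'v fml"
  | FEx nat "'v fml"

primrec fv_trm :: "'v trm \<Rightarrow> nat set" where
  "fv_trm (Var n) = {n}"
| "fv_trm (Const u) = {}"

primrec fv :: "'v fml \<Rightarrow> nat set" where
  "fv (FMem s t) = fv_trm s \<union> fv_trm t"
| "fv (FEq s t) = fv_trm s \<union> fv_trm t"
| "fv FFalse = {}"
| "fv (FNot \<phi>) = fv \<phi>"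
| "fv (FAnd \<phi> \<psi>) = fv \<phi> \<union> fv \<psi>"
| "fv (FOr \<phi> \<psi>) = fv \<phi> \<union> fv \<psi>"
| "fv (FImp \<phi> \<psi>) = fv \<phi> \<union> fv \<psi>"
| "fv (FIff \<phi> \<psi>) = fv \<phi> \<union> fv \<psi>"
| "fv (FAll n \<phi>) = fv \<phi> - {n}"
| "fv (FEx n \<phi>) = fv \<phi> - {n}"

definition Sent :: "('b \<Rightarrow> 'v::set_universe) \<Rightarrow> 'v fml set" where
  "Sent c = {\<phi>. fv \<phi> = {} \<and> set_fml \<phi> \<subseteq> VB c}"  \<comment> \<open>\<open>set_fml \<phi>\<close>: the constants in \<open>\<phi>\<close>\<close>

primrec subst_trm :: "nat \<Rightarrow> 'v \<Rightarrow> 'v trm \<Rightarrow> 'v trm" where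
  "subst_trm n u (Var m) = (if m = n then Const u else Var m)"
| "subst_trm n u (Const w) = Const w"

primrec subst :: "nat \<Rightarrow> 'v \<Rightarrow> 'v fml \<Rightarrow> 'v fml" where
  "subst n u (FMem s t) = FMem (subst_trm n u s) (subst_trm n u t)"
| "subst n u (FEq s t) = FEq (subst_trm n u s) (subst_trm n u t)"
| "subst n u FFalse = FFalse"
| "subst n u (FNot \<phi>) = FNot (subst n u \<phi>)"
| "subst n u (FAnd \<phi> \<psi>) = FAnd (subst n u \<phi>) (subst n u \<psi>)"
| "subst n u (FOr \<phi> \<psi>) = FOr (subst n u \<phi>) (subst n u \<psi>)"
| "subst n u (FImp \<phi> \<psi>) = FImp (subst n u \<phi>) (subst n u \<psi>)"
| "subst n u (FIff \<phi> \<psi>) = FIff (subst n u \<phi>) (subst n u \<psi>)"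
| "subst n u (FAll m \<phi>) = (if m = n then FAll m \<phi> else FAll m (subst n u \<phi>))"
| "subst n u (FEx m \<phi>) = (if m = n then FEx m \<phi> else FEx m (subst n u \<phi>))"

primrec fml_depth :: "'v fml \<Rightarrow> nat" where
  "fml_depth (FMem s t) = 0"
| "fml_depth (FEq s t) = 0"
| "fml_depth FFalse = 0"
| "fml_depth (FNot \<phi>) = Suc (fml_depth \<phi>)"
| "fml_depth (FAnd \<phi> \<psi>) = Suc (fml_depth \<phi> + fml_depth \<psi>)"
| "fml_depth (FOr \<phi> \<psi>) = Suc (fml_depth \<phi> + fml_depth \<psi>)"
| "fml_depth (FImp \<phi> \<psi>) = Suc (fml_depth \<phi> + fml_depth \<psi>)"
| "fml_depth (FIff \<phi> \<psi>) = Suc (fml_depth \<phi> + fml_depth \<psi>)"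
| "fml_depth (FAll n \<phi>) = Suc (fml_depth \<phi>)"
| "fml_depth (FEx n \<phi>) = Suc (fml_depth \<phi>)"

lemma fml_depth_subst [simp]: "fml_depth (subst n u \<phi>) = fml_depth \<phi>"
  by (induction \<phi>) auto

text \<open>
  The Boolean value is only meaningful on \<open>Sent c\<close>; an atomic formula with a variable,
  which is not a sentence, gets the dummy value \<open>\<bottom>\<close>.
\<close>

function bval :: "('b::{boolean_algebra, complete_lattice} \<Rightarrow> 'v::set_universe) \<Rightarrow> 'v fml \<Rightarrow> 'b" where
  "bval c (FMem s t) = (case (s, t) of (Const u, Const v) \<Rightarrow> bmem c u v | _ \<Rightarrow> bot)"
| "bval c (FEq s t) = (case (s, t) of (Const u, Const v) \<Rightarrow> beq c u v | _ \<Rightarrow> bot)"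
| "bval c FFalse = bot"
| "bval c (FNot \<phi>) = - bval c \<phi>"
| "bval c (FAnd \<phi> \<psi>) = bval c \<phi> \<sqinter> bval c \<psi>"
| "bval c (FOr \<phi> \<psi>) = bval c \<phi> \<squnion> bval c \<psi>"
| "bval c (FImp \<phi> \<psi>) = bimp (bval c \<phi>) (bval c \<psi>)"
| "bval c (FIff \<phi> \<psi>) = bimp (bval c \<phi>) (bval c \<psi>) \<sqinter> bimp (bval c \<psi>) (bval c \<phi>)"
| "bval c (FAll n \<phi>) = (\<Sqinter>u\<in>VB c. bval c (subst n u \<phi>))"
| "bval c (FEx n \<phi>) = (\<Squnion>u\<in>VB c. bval c (subst n u \<phi>))"
  by pat_completeness auto
termination
  by (relation "measure (\<lambda>(c, \<phi>). fml_depth \<phi>)") auto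


section \<open>Modal logic and translation models\<close>

datatype 'p mfml =
    PVar 'p
  | MFalse
  | MNot "'p mfml"
  | MAnd "'p mfml" "'p mfml"
  | MOr "'p mfml" "'p mfml"
  | MImp "'p mfml" "'p mfml"
  | MIff "'p mfml" "'p mfml"
  | Box "'p mfml"
  | Dia "'p mfml"

record ('w, 'p) kripke =
  states :: "'w set"
  acc :: "'w \<Rightarrow> 'w \<Rightarrow> bool"
  atoms :: "'w \<Rightarrow> 'p \<Rightarrow> bool"

primrec sat :: "('w, 'p) kripke \<Rightarrow> 'w \<Rightarrow> 'p mfml \<Rightarrow> bool" where
  "sat M w (PVar p) = atoms M w p"
| "sat M w MFalse = False"
| "sat M w (MNot \<phi>) = (\<not> sat M w \<phi>)"
| "sat M w (MAnd \<phi> \<psi>) = (sat M w \<phi> \<and> sat M w \<psi>)"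
| "sat M w (MOr \<phi> \<psi>) = (sat M w \<phi> \<or> sat M w \<psi>)"
| "sat M w (MImp \<phi> \<psi>) = (sat M w \<phi> \<longrightarrow> sat M w \<psi>)"
| "sat M w (MIff \<phi> \<psi>) = (sat M w \<phi> \<longleftrightarrow> sat M w \<psi>)"
| "sat M w (Box \<phi>) = (\<forall>v\<in>states M. acc M w v \<longrightarrow> sat M v \<phi>)"
| "sat M w (Dia \<phi>) = (\<exists>v\<in>states M. acc M w v \<and> sat M v \<phi>)"

definition model_valid :: "('w, 'p) kripke \<Rightarrow> 'p mfml \<Rightarrow> bool" where
  "model_valid M \<phi> \<longleftrightarrow> (\<forall>w\<in>states M. sat M w \<phi>)"

definition B_translations :: "('b \<Rightarrow> 'v::set_universe) \<Rightarrow> ('p \<Rightarrow> 'v fml) set" where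
  "B_translations c = {T. \<forall>p. T p \<in> Sent c}"

definition translation_model ::
  "('b::{boolean_algebra, complete_lattice} \<Rightarrow> 'v::set_universe) \<Rightarrow> 'b set \<Rightarrow> ('p \<Rightarrow> 'v fml) \<Rightarrow> ('b, 'p) kripke"
  where
  "translation_model c W T =
     \<lparr>states = W, acc = (\<lambda>a b. a \<sqinter> b \<noteq> bot), atoms = (\<lambda>b p. b \<le> bval c (T p))\<rparr>"

definition Log_sub_sharp ::
  "('b::{boolean_algebra, complete_lattice} \<Rightarrow> 'v::set_universe) \<Rightarrow> 'p mfml set" where
  "Log_sub_sharp c = {\<phi>. \<forall>W T. W \<noteq> {} \<and> W \<subseteq> UNIV - {bot} \<and> T \<in> B_translations c \<longrightarrow>
                              model_valid (translation_model c W T) \<phi>}"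

definition boolean_isomorphism :: "('a::boolean_algebra \<Rightarrow> 'b::boolean_algebra) \<Rightarrow> bool" where
  "boolean_isomorphism f \<longleftrightarrow> bij f \<and> f bot = bot \<and> f top = top \<and>
     (\<forall>x y. f (x \<sqinter> y) = f x \<sqinter> f y) \<and> (\<forall>x y. f (x \<squnion> y) = f x \<squnion> f y) \<and> (\<forall>x. f (- x) = - f x)"

end

(* Every a in B is the value of the sentence "0 is a member of {(0, a)}", so some translation gives
   every propositional variable the value a.  For 0 < a < 1 the points a and -a are both adjacent to
   1 but not to each other, and a is the only state of {a, -a, 1} below a.  Hence p holds at a while
   Box p fails there; at -a, Box (Not p) holds while Box (Box (Not p)) fails; at 1, Dia p holds while
   Box (Dia p) fails. *)

theory Submission
  imports Defs
begin

lemma empty_exists: "\<exists>e::'v::set_universe. \<forall>z. \<not> z \<^bold>\<in> e"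
  using infinity by blast

lemma upair_eq_iff: "upair x y = upair x' y' \<longleftrightarrow> (x = x' \<and> y = y') \<or> (x = y' \<and> y = x')"
proof
  assume eq: "upair x y = upair x' y'"
  have "z = x \<or> z = y \<longleftrightarrow> z = x' \<or> z = y'" for z
    using eq by (metis upair_iff)
  then show "(x = x' \<and> y = y') \<or> (x = y' \<and> y = x')" by metis
next
  assume "(x = x' \<and> y = y') \<or> (x = y' \<and> y = x')"
  then show "upair x y = upair x' y'" by (intro extensionality) auto
qed

lemma opair_eq_iff [simp]: "opair x y = opair x' y' \<longleftrightarrow> x = x' \<and> y = y'"
  unfolding opair_def upair_eq_iff by auto

lemma singleton_function:
  fixes f :: "'v::set_universe"
  assumes f: "\<And>z. z \<^bold>\<in> f \<longleftrightarrow> z = opair x y"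
  shows "is_function f" "vdom f = {x}" "vran f = {y}"
  by (auto simp: is_function_def vdom_def vran_def f)

text \<open>The stage is kept as a second conclusion because a later name needs its domain inside
  one earlier stage, not merely inside \<open>VB c\<close>.\<close>

lemma VB_I:
  assumes "ordinal \<alpha>" "is_function x" "vran x \<subseteq> range c" "\<xi> \<^bold>\<in> \<alpha>" "vdom x \<subseteq> V_stage c \<xi>"
  shows "x \<in> VB c" "x \<in> V_stage c \<alpha>"
proof -
  show "x \<in> V_stage c \<alpha>" using assms by (subst V_stage.simps) blast
  then show "x \<in> VB c" using assms(1) by (auto simp: VB_def)
qed

text \<open>The join for membership in a name with one domain element \<open>e\<close> has the
  single term \<open>a \<sqinter> beq c e e\<close>, so everything rests on
  \<open>beq c e e = top\<close>. This frees the choice of a translation from set theory: any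
  valuation can be prescribed.\<close>

lemma sentence_with_value:
  fixes c :: "'b::{boolean_algebra, complete_lattice} \<Rightarrow> 'v::set_universe"
  assumes "inj c"
  shows "\<exists>\<phi>\<in>Sent c. bval c \<phi> = a"
proof -
  obtain e :: 'v where e: "\<And>z. \<not> z \<^bold>\<in> e" using empty_exists by blast
  define v where "v = upair (opair e (c a)) (opair e (c a))"
  have v: "z \<^bold>\<in> v \<longleftrightarrow> z = opair e (c a)" for z by (simp add: v_def)
  \<comment> \<open>These are the ordinals 1 and 2: \<open>e\<close> enters the hierarchy at stage 1
    and \<open>v\<close> at stage 2.\<close>
  have ord1: "ordinal (upair e e)"
    and ord2: "ordinal (upair e (upair e e))"
    using e by (auto simp: ordinal_def transitive_set_def)
  have e_dom: "vdom e = {}" and e_ran: "vran e = {}" and e_fun: "is_function e"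
    using e by (auto simp: vdom_def vran_def is_function_def)
  have e_VB: "e \<in> VB c" "e \<in> V_stage c (upair e e)"
    \<comment> \<open>The earlier stage is indexed by \<open>e\<close>, the ordinal 0; an empty
      domain lies in it trivially.\<close>
    using VB_I[OF ord1 e_fun, of c e] by (auto simp: e_dom e_ran)
  have v_VB: "v \<in> VB c"
    by (rule VB_I(1)[OF ord2, of v c "upair e e"])
       (use singleton_function[of v, OF v] e_VB(2) in auto)
  have "name_val c v e = a"
    \<comment> \<open>Injectivity of \<open>c\<close> makes \<open>a\<close> the unique element
      described by \<open>name_val\<close>.\<close>
    unfolding name_val_def v using assms by (auto dest: injD)
  \<comment> \<open>Both meets run over the empty domain of \<open>e\<close>.\<close>
  moreover have "beq c e e = top" by (simp add: beq.simps e_dom)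
  ultimately have "bmem c e v = a"
    by (simp add: bmem.simps singleton_function(2)[of v, OF v])
  then have "bval c (FMem (Const e) (Const v)) = a" by simp
  moreover have "FMem (Const e) (Const v) \<in> Sent c"
    using e_VB v_VB by (simp add: Sent_def)
  ultimately show ?thesis by blast
qed

text \<open>An injection into \<open>bool\<close> leaves no value for a third element; conversely,
  if only \<open>bot\<close> and \<open>top\<close> exist, the test \<open>x = top\<close> is an
  isomorphism.\<close>

lemma not_two_element_iff_intermediate:
  assumes "(bot :: 'b::boolean_algebra) \<noteq> top"
  shows "\<not> (\<exists>f :: 'b \<Rightarrow> bool. boolean_isomorphism f) \<longleftrightarrow> (\<exists>a :: 'b. bot < a \<and> a < top)"
proof
  assume "\<exists>a :: 'b. bot < a \<and> a < top"
  then obtain a :: 'b where a: "bot < a" "a < top" by blast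
  show "\<not> (\<exists>f :: 'b \<Rightarrow> bool. boolean_isomorphism f)"
  proof
    assume "\<exists>f :: 'b \<Rightarrow> bool. boolean_isomorphism f"
    then obtain f :: "'b \<Rightarrow> bool" where f: "inj f" "f bot = bot" "f top = top"
      unfolding boolean_isomorphism_def bij_def by blast
    have "f a = f bot \<or> f a = f top" using f by auto
    then show False using a injD[OF f(1)] by (metis less_irrefl)
  qed
next
  assume no_iso: "\<not> (\<exists>f :: 'b \<Rightarrow> bool. boolean_isomorphism f)"
  show "\<exists>a :: 'b. bot < a \<and> a < top"
  proof (rule ccontr)
    assume "\<not> (\<exists>a :: 'b. bot < a \<and> a < top)"
    then have two: "x = bot \<or> x = top" for x :: 'b
      by (metis bot.not_eq_extremum top.not_eq_extremum)
    have "inj (\<lambda>x :: 'b. x = top)" by (rule injI) (metis two)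
    moreover have "surj (\<lambda>x :: 'b. x = top)" unfolding surj_def by (metis (full_types) assms)
    moreover have "sup x y = top \<longleftrightarrow> x = top \<or> y = top" for x y :: 'b
      using two[of x] two[of y] assms by auto
    moreover have "- x = top \<longleftrightarrow> x \<noteq> top" for x :: 'b
      using two[of x] assms by auto
    ultimately have "boolean_isomorphism (\<lambda>x :: 'b. x = top)"
      using assms by (simp add: boolean_isomorphism_def bij_def)
    then show False using no_iso by blast
  qed
qed

text \<open>The refuting state \<open>w\<close> also witnesses that \<open>W\<close> is
  nonempty.\<close>

lemma not_in_Log_sub_sharpI:
  assumes "T \<in> B_translations c" "W \<subseteq> UNIV - {bot}" "w \<in> W"
    and "\<not> sat (translation_model c W T) w \<phi>"
  shows "\<phi> \<notin> Log_sub_sharp c"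
proof -
  have "\<not> model_valid (translation_model c W T) \<phi>"
    unfolding model_valid_def using assms(3,4) by (auto simp: translation_model_def)
  then show ?thesis
    unfolding Log_sub_sharp_def using assms(1-3) by blast
qed

theorem corollary6p6:
  fixes c :: "'b::{boolean_algebra, complete_lattice} \<Rightarrow> 'v::set_universe"
  assumes "represents_in_universe c"
    and "(bot :: 'b) \<noteq> top"
  shows "(\<not> (\<exists>f :: 'b \<Rightarrow> bool. boolean_isomorphism f) \<longleftrightarrow> (\<exists>a :: 'b. bot < a \<and> a < top)) \<and>
    (\<not> (\<exists>f :: 'b \<Rightarrow> bool. boolean_isomorphism f) \<longrightarrow>
       (\<forall>p :: 'p::countable. MIff (Box (PVar p)) (PVar p) \<notin> Log_sub_sharp c) \<and>
       (\<exists>\<phi> :: 'p mfml. MImp (Box \<phi>) (Box (Box \<phi>)) \<notin> Log_sub_sharp c) \<and>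
       (\<exists>\<phi> :: 'p mfml. MImp (Dia \<phi>) (Box (Dia \<phi>)) \<notin> Log_sub_sharp c))"
proof (rule conjI[OF not_two_element_iff_intermediate[OF assms(2)] impI])
  assume "\<not> (\<exists>f :: 'b \<Rightarrow> bool. boolean_isomorphism f)"
  then obtain a :: 'b where a: "bot < a" "a < top"
    using not_two_element_iff_intermediate[OF assms(2)] by blast
  obtain \<sigma> where \<sigma>: "\<sigma> \<in> Sent c" "bval c \<sigma> = a"
    using sentence_with_value assms(1) unfolding represents_in_universe_def by blast
  define T :: "'p \<Rightarrow> 'v fml" where "T = (\<lambda>_. \<sigma>)"
  define W where "W = {a, - a, top}"
  define M where "M = translation_model c W T"
  have T: "T \<in> B_translations c" using \<sigma> by (simp add: T_def B_translations_def)
  \<comment> \<open>If \<open>- a\<close> were \<open>bot\<close>, complementing would give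
    \<open>a = top\<close>.\<close>
  have nbot: "a \<noteq> bot" "- a \<noteq> bot"
    using a double_compl[of a] by (auto simp del: double_compl)
  have W: "W \<subseteq> UNIV - {bot}" using nbot assms(2) by (auto simp: W_def)
  have in_W: "a \<in> W" "- a \<in> W" "top \<in> W" by (simp_all add: W_def)
  note countermodel = not_in_Log_sub_sharpI[OF T W, folded M_def]
  have [simp]: "states M = W" "atoms M b p \<longleftrightarrow> b \<le> a" "acc M b d \<longleftrightarrow> inf b d \<noteq> bot" for b d p
    using \<sigma>(2) by (simp_all add: M_def translation_model_def T_def)
  \<comment> \<open>These exclude \<open>- a\<close> and \<open>top\<close> from the states
    satisfying a variable; for \<open>top\<close>, \<open>top \<le> a\<close> would force
    \<open>a = top\<close>.\<close>
  have not_le: "\<not> - a \<le> a" "a \<noteq> top"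
  proof -
    show "\<not> - a \<le> a"
    proof
      assume "- a \<le> a"
      then have "sup a (- a) = a" by (rule sup_absorb1)
      then show False using a by simp
    qed
    show "a \<noteq> top" using a by simp
  qed
  \<comment> \<open>The successor \<open>top\<close> of \<open>a\<close> refutes
    \<open>Box (PVar p)\<close>.\<close>
  have "\<not> sat M a (MIff (Box (PVar p)) (PVar p))" for p :: 'p
    using nbot not_le by (simp add: W_def top_unique)
  \<comment> \<open>Transitivity fails along \<open>- a\<close>, \<open>top\<close>,
    \<open>a\<close>: two steps reach the state satisfying \<open>p\<close>, one step does
    not.\<close>
  moreover have "\<not> sat M (- a) (MImp (Box (MNot (PVar p))) (Box (Box (MNot (PVar p)))))" for p :: 'p
    using nbot not_le by (simp add: W_def top_unique)
  \<comment> \<open>From \<open>top\<close> the state \<open>a\<close> witnesses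
    \<open>Dia (PVar p)\<close>, while the successor \<open>- a\<close> does not see
    \<open>a\<close>.\<close>
  moreover have "\<not> sat M top (MImp (Dia (PVar p)) (Box (Dia (PVar p))))" for p :: 'p
    using nbot not_le by (simp add: W_def top_unique)
  ultimately show "(\<forall>p :: 'p. MIff (Box (PVar p)) (PVar p) \<notin> Log_sub_sharp c) \<and>
       (\<exists>\<phi> :: 'p mfml. MImp (Box \<phi>) (Box (Box \<phi>)) \<notin> Log_sub_sharp c) \<and>
       (\<exists>\<phi> :: 'p mfml. MImp (Dia \<phi>) (Box (Dia \<phi>)) \<notin> Log_sub_sharp c)"
    using countermodel in_W by blast
qed

end
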